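(* Let $(A,\mu,R,d)$ be a modified Rota-Baxter AssDer pair of weight $\kappa$, and let $(\mu_t,R_t,d_t)$ be a formal one-parameter deformation of it. Then its infinitesimal $(\mu_1,R_1,d_1)$, regarded as the element $((\mu_1,R_1),d_1)\in\mathfrak{C}^2_{\mathrm{mRBAD}^\kappa}(A;A)$, is a $2$-cocycle in the cohomology complex of $(A,\mu,R,d)$ with coefficients in itself, i.e. $\mathfrak{D}^2_{\mathrm{mRBAD}^\kappa}((\mu_1,R_1),d_1)=0$. Moreover, the corresponding cohomology class in $\mathcal{H}^2_{\mathrm{mRBAD}^\kappa}(A,A)$ depends only on the equivalence class of the deformation: if $(\mu_t,R_t,d_t)$ and $(\mu'_t,R'_t,d'_t)$ are equivalent formal one-parameter deformations of $(A,\mu,R,d)$, then their infinitesimals have the same class in $\mathcal{H}^2_{\mathrm{mRBAD}^\kappa}(A,A)$.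
   Context: All vector spaces and linear maps are over a field $\mathbb{K}$, and $\kappa\in\mathbb{K}$ is fixed. A modified Rota-Baxter associative algebra of weight $\kappa$ is an associative (not necessarily unital) algebra $(A,\mu)$ with a linear map $R:A\to A$ such that $\mu(R(a),R(b))=R\big(\mu(R(a),b)+\mu(a,R(b))\big)+\kappa\,\mu(a,b)$ for all $a,b\in A$. A modified Rota-Baxter AssDer pair $(A,\mu,R,d)$ of weight $\kappa$ is such an algebra together with a derivation $d:A\to A$ of $(A,\mu)$ with $R\circ d=d\circ R$. Deformations. A formal one-parameter deformation of $(A,\mu,R,d)$ is a triple $(\mu_t,R_t,d_t)$ of formal power series $\mu_t=\sum_{i\ge0}\mu_it^i$, $R_t=\sum_{i\ge0}R_it^i$, $d_t=\sum_{i\ge0}d_it^i$ with $\mu_i\in\mathrm{Hom}(A^{\otimes2},A)$, $R_i,d_i\in\mathrm{Hom}(A,A)$, $\mu_0=\mu$, $R_0=R$, $d_0=d$, such that $(A[\![t]\!],\mu_t,R_t,d_t)$ (with $\mathbb{K}[\![t]\!]$-(bi)linearly extended maps) is a modified Rota-Baxter AssDer pair of weight $\kappa$ over $\mathbb{K}[\![t]\!]$: $\mu_t$ is associative, $R_t$ is a modified Rota-Baxter operator of weight $\kappa$, $d_t$ is a derivation and $R_t\circ d_t=d_t\circ R_t$. Its infinitesimal is $(\mu_1,R_1,d_1)$. Two deformations $(\mu_t,R_t,d_t)$ and $(\mu_t',R_t',d_t')$ are equivalent if there is $\varphi_t=\sum_{i\ge0}\varphi_it^i$ with $\varphi_i\in\mathrm{Hom}(A,A)$,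 $\varphi_0=\mathrm{Id}$, such that $\varphi_t(\mu_t(a,b))=\mu_t'(\varphi_t(a),\varphi_t(b))$, $\varphi_t\circ R_t=R_t'\circ\varphi_t$ and $\varphi_t\circ d_t=d_t'\circ\varphi_t$. Cohomology of $(A,\mu,R,d)$ with coefficients in itself. For $n\ge1$ let $C^n(A;A)=\mathrm{Hom}(A^{\otimes n},A)$. For $f\in C^n(A;A)$ define $$\delta^n_{\mathrm{Hoch}}(f)(a_1,\dots,a_{n+1})=(-1)^{n+1}\mu(a_1,f(a_2,\dots,a_{n+1}))+\mu(f(a_1,\dots,a_n),a_{n+1})+\sum_{i=1}^n(-1)^{i+n+1}f(a_1,\dots,\mu(a_i,a_{i+1}),\dots,a_{n+1}),$$ $$\begin{aligned}\delta^n_{\mathrm{mHoch}}(f)(a_1,\dots,a_{n+1})=&(-1)^{n+1}\mu(R(a_1),f(a_2,\dots,a_{n+1}))-(-1)^{n+1}R(\mu(a_1,f(a_2,\dots,a_{n+1})))\\&+\mu(f(a_1,\dots,a_n),R(a_{n+1}))-R(\mu(f(a_1,\dots,a_n),a_{n+1}))\\&+\sum_{i=1}^n(-1)^{i+n+1}f(a_1,\dots,\mu(R(a_i),a_{i+1})+\mu(a_i,R(a_{i+1})),\dots,a_{n+1}),\end{aligned}$$ $$\begin{aligned}\phi^n(f)(a_1,\dots,a_n)=&f(R(a_1),\dots,R(a_n))-\sum_{\substack{1\le i_1<\dots<i_r\le n\\ r\ \mathrm{odd}}}(-\kappa)^{\frac{r-1}{2}}R\big(f(R(a_1),\dots,a_{i_1},\dots,a_{i_r},\dots,R(a_n))\big)\\&+\sum_{\substack{1\le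 i_1<\dots<i_r\le n\\ r\ge2\ \mathrm{even}}}(-\kappa)^{\frac r2}f(R(a_1),\dots,a_{i_1},\dots,a_{i_r},\dots,R(a_n)),\end{aligned}$$ where in each summand the argument in position $j$ is $a_j$ if $j\in\{i_1,\dots,i_r\}$ and $R(a_j)$ otherwise. Let $C^1_{\mathrm{mRBAA}^\kappa}(A;A)=\mathrm{Hom}(A,A)$ and $C^n_{\mathrm{mRBAA}^\kappa}(A;A)=C^n(A;A)\oplus C^{n-1}(A;A)$ for $n\ge2$, with $\partial^1_{\mathrm{mRBAA}^\kappa}(f)=(\delta^1_{\mathrm{Hoch}}f,-\phi^1f)$ and $\partial^n_{\mathrm{mRBAA}^\kappa}(f,g)=(\delta^n_{\mathrm{Hoch}}f,-\delta^{n-1}_{\mathrm{mHoch}}g-\phi^nf)$ for $n\ge2$. For $f\in C^n(A;A)$ put $\Delta^n(f)=\sum_{i=1}^nf\circ(\mathrm{Id}\otimes\cdots\otimes d\otimes\cdots\otimes\mathrm{Id})-d\circ f$ ($d$ in the $i$-th place), and $\Delta^n(f,g)=(\Delta^nf,\Delta^{n-1}g)$ for $(f,g)\in C^n_{\mathrm{mRBAA}^\kappa}(A;A)$, $n\ge2$. Let $\mathfrak{C}^1_{\mathrm{mRBAD}^\kappa}(A;A)=\mathrm{Hom}(A,A)$, $\mathfrak{C}^n_{\mathrm{mRBAD}^\kappa}(A;A)=C^n_{\mathrm{mRBAA}^\kappa}(A;A)\times C^{n-1}_{\mathrm{mRBAA}^\kappa}(A;A)$ for $n\ge2$, $\mathfrak{D}^1_{\mathrm{mRBAD}^\kappa}(f)=(\partial^1_{\mathrm{mRBAA}^\kappa}f,-\Delta^1f)$,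 and $\mathfrak{D}^n_{\mathrm{mRBAD}^\kappa}(F,G)=(\partial^n_{\mathrm{mRBAA}^\kappa}F,\partial^{n-1}_{\mathrm{mRBAA}^\kappa}G+(-1)^n\Delta^nF)$ for $n\ge2$. This is a cochain complex, and $\mathcal{H}^2_{\mathrm{mRBAD}^\kappa}(A,A)=\ker\mathfrak{D}^2_{\mathrm{mRBAD}^\kappa}/\operatorname{im}\mathfrak{D}^1_{\mathrm{mRBAD}^\kappa}$. *)

theory Defs
  imports
    "HOL-Computational_Algebra.Formal_Power_Series"
    "HOL-Library.Function_Algebras"
    "HOL-Library.Product_Plus"
begin

section \<open>Modified Rota-Baxter AssDer pairs\<close>

text \<open>
  The underlying module is a whole type \<open>'a\<close> with scalar action \<open>s\<close>. The structures are defined over a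
  commutative ring, because they are used both over the ground field and over the ring of formal
  power series.
\<close>

definition bilinear_map ::
  "('r::comm_ring_1 \<Rightarrow> 'a::ab_group_add \<Rightarrow> 'a) \<Rightarrow> ('a \<Rightarrow> 'a \<Rightarrow> 'a) \<Rightarrow> bool" where
  "bilinear_map s m \<longleftrightarrow>
     (\<forall>a. module_hom s s (\<lambda>b. m a b)) \<and> (\<forall>b. module_hom s s (\<lambda>a. m a b))"

locale mRB_algebra = module s
  for s :: "'r::comm_ring_1 \<Rightarrow> 'a::ab_group_add \<Rightarrow> 'a" +
  fixes \<kappa> :: 'r and \<mu> :: "'a \<Rightarrow> 'a \<Rightarrow> 'a" and R :: "'a \<Rightarrow> 'a"
  assumes bilinear_mult: "bilinear_map s \<mu>"
    and assoc_mult: "\<mu> (\<mu> a b) c = \<mu> a (\<mu> b c)"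
    and linear_R: "module_hom s s R"
    and modified_Rota_Baxter: "\<mu> (R a) (R b) = R (\<mu> (R a) b + \<mu> a (R b)) + s \<kappa> (\<mu> a b)"

locale mRB_AssDer_pair = mRB_algebra s \<kappa> \<mu> R
  for s :: "'r::comm_ring_1 \<Rightarrow> 'a::ab_group_add \<Rightarrow> 'a"
    and \<kappa> :: 'r and \<mu> :: "'a \<Rightarrow> 'a \<Rightarrow> 'a" and R :: "'a \<Rightarrow> 'a" +
  fixes d :: "'a \<Rightarrow> 'a"
  assumes linear_d: "module_hom s s d"
    and derivation: "d (\<mu> a b) = \<mu> (d a) b + \<mu> a (d b)"
    and commute: "R \<circ> d = d \<circ> R"


section \<open>Formal one-parameter deformations\<close>

text \<open>
  The module of formal power series with coefficients in \<open>'a\<close> is the type \<open>'a fps\<close>. A sequence of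
  (bi)linear maps stands for a formal power series of maps, and \<open>lin_ext\<close>, \<open>bilin_ext\<close> are the
  induced operations on \<open>'a fps\<close>.
\<close>

definition fps_scale ::
  "('k::comm_ring_1 \<Rightarrow> 'a::ab_group_add \<Rightarrow> 'a) \<Rightarrow> 'k fps \<Rightarrow> 'a fps \<Rightarrow> 'a fps" where
  "fps_scale s c f = Abs_fps (\<lambda>n. \<Sum>i\<le>n. s (fps_nth c i) (fps_nth f (n - i)))"

definition lin_ext :: "(nat \<Rightarrow> 'a::ab_group_add \<Rightarrow> 'a) \<Rightarrow> 'a fps \<Rightarrow> 'a fps" where
  "lin_ext T f = Abs_fps (\<lambda>n. \<Sum>i\<le>n. T i (fps_nth f (n - i)))"

definition bilin_ext ::
  "(nat \<Rightarrow> 'a::ab_group_add \<Rightarrow> 'a \<Rightarrow> 'a) \<Rightarrow> 'a fps \<Rightarrow> 'a fps \<Rightarrow> 'a fps" where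
  "bilin_ext m f g =
     Abs_fps (\<lambda>n. \<Sum>i\<le>n. \<Sum>j\<le>n - i. m i (fps_nth f j) (fps_nth g (n - i - j)))"

definition formal_deformation ::
  "('k::field \<Rightarrow> 'a::ab_group_add \<Rightarrow> 'a) \<Rightarrow> 'k \<Rightarrow> ('a \<Rightarrow> 'a \<Rightarrow> 'a) \<Rightarrow> ('a \<Rightarrow> 'a) \<Rightarrow> ('a \<Rightarrow> 'a)
   \<Rightarrow> (nat \<Rightarrow> 'a \<Rightarrow> 'a \<Rightarrow> 'a) \<Rightarrow> (nat \<Rightarrow> 'a \<Rightarrow> 'a) \<Rightarrow> (nat \<Rightarrow> 'a \<Rightarrow> 'a) \<Rightarrow> bool" where
  "formal_deformation s \<kappa> \<mu> R d \<mu>t Rt dt \<longleftrightarrow>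
     (\<forall>i. bilinear_map s (\<mu>t i)) \<and> (\<forall>i. module_hom s s (Rt i)) \<and> (\<forall>i. module_hom s s (dt i)) \<and>
     \<mu>t 0 = \<mu> \<and> Rt 0 = R \<and> dt 0 = d \<and>
     mRB_AssDer_pair (fps_scale s) (fps_const \<kappa>) (bilin_ext \<mu>t) (lin_ext Rt) (lin_ext dt)"

definition equivalent_deformations ::
  "('k::field \<Rightarrow> 'a::ab_group_add \<Rightarrow> 'a)
   \<Rightarrow> (nat \<Rightarrow> 'a \<Rightarrow> 'a \<Rightarrow> 'a) \<Rightarrow> (nat \<Rightarrow> 'a \<Rightarrow> 'a) \<Rightarrow> (nat \<Rightarrow> 'a \<Rightarrow> 'a)
   \<Rightarrow> (nat \<Rightarrow> 'a \<Rightarrow> 'a \<Rightarrow> 'a) \<Rightarrow> (nat \<Rightarrow> 'a \<Rightarrow> 'a) \<Rightarrow> (nat \<Rightarrow> 'a \<Rightarrow> 'a) \<Rightarrow> bool" where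
  "equivalent_deformations s \<mu>t Rt dt \<mu>t' Rt' dt' \<longleftrightarrow>
     (\<exists>\<phi>t. (\<forall>i. module_hom s s (\<phi>t i)) \<and> \<phi>t 0 = id \<and>
       (\<forall>a b. lin_ext \<phi>t (bilin_ext \<mu>t a b) = bilin_ext \<mu>t' (lin_ext \<phi>t a) (lin_ext \<phi>t b)) \<and>
       lin_ext \<phi>t \<circ> lin_ext Rt = lin_ext Rt' \<circ> lin_ext \<phi>t \<and>
       lin_ext \<phi>t \<circ> lin_ext dt = lin_ext dt' \<circ> lin_ext \<phi>t)"


section \<open>Cochains\<close>

text \<open>
  A cochain of degree \<open>n \<ge> 1\<close> is an \<open>n\<close>-linear function of the list \<open>[a\<^sub>1, \<dots>, a\<^sub>n]\<close>, extended by 0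
  to the lists of any other length, so that equality of cochains is equality of functions. Sums,
  differences and 0 of cochains are those of functions and pairs. There are no cochains of degree 0
  in the complexes below; taking the zero space there makes the degree 1 spaces instances of the
  general ones, with \<open>f\<close> encoded as \<open>(f, 0)\<close>.
\<close>

type_synonym 'a cochain = "'a list \<Rightarrow> 'a"

definition Hom_tensor ::
  "('k::field \<Rightarrow> 'a::ab_group_add \<Rightarrow> 'a) \<Rightarrow> nat \<Rightarrow> 'a cochain set" where
  "Hom_tensor s n = (if n = 0 then {0} else
     {f. (\<forall>as. length as \<noteq> n \<longrightarrow> f as = 0) \<and>
         (\<forall>as i. length as = n \<longrightarrow> i < n \<longrightarrow> module_hom s s (\<lambda>a. f (as[i := a])))})"

definition cochain1 :: "('a::ab_group_add \<Rightarrow> 'a) \<Rightarrow> 'a cochain" where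
  "cochain1 f = (\<lambda>as. if length as = 1 then f (as ! 0) else 0)"

definition cochain2 :: "('a::ab_group_add \<Rightarrow> 'a \<Rightarrow> 'a) \<Rightarrow> 'a cochain" where
  "cochain2 m = (\<lambda>as. if length as = 2 then m (as ! 0) (as ! 1) else 0)"


section \<open>The operators on cochains\<close>

text \<open>
  \<open>contract m i as\<close> is \<open>[a\<^sub>1, \<dots>, m a\<^sub>i a\<^bsub>i+1\<^esub>, \<dots>]\<close>, for \<open>1 \<le> i < length as\<close>. Entry \<open>a\<^sub>i\<close> is
  \<open>as ! (i - 1)\<close>.
\<close>

definition contract :: "('a \<Rightarrow> 'a \<Rightarrow> 'a) \<Rightarrow> nat \<Rightarrow> 'a list \<Rightarrow> 'a list" where
  "contract m i as = take (i - 1) as @ [m (as ! (i - 1)) (as ! i)] @ drop (i + 1) as"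

definition delta_Hoch ::
  "('k::field \<Rightarrow> 'a::ab_group_add \<Rightarrow> 'a) \<Rightarrow> ('a \<Rightarrow> 'a \<Rightarrow> 'a) \<Rightarrow> nat \<Rightarrow> 'a cochain \<Rightarrow> 'a cochain" where
  "delta_Hoch s \<mu> n f = (\<lambda>as. if length as \<noteq> n + 1 then 0 else
     s ((-1) ^ (n + 1)) (\<mu> (hd as) (f (tl as)))
     + \<mu> (f (butlast as)) (last as)
     + (\<Sum>i = 1..n. s ((-1) ^ (i + n + 1)) (f (contract \<mu> i as))))"

definition delta_mHoch ::
  "('k::field \<Rightarrow> 'a::ab_group_add \<Rightarrow> 'a) \<Rightarrow> ('a \<Rightarrow> 'a \<Rightarrow> 'a) \<Rightarrow> ('a \<Rightarrow> 'a)
   \<Rightarrow> nat \<Rightarrow> 'a cochain \<Rightarrow> 'a cochain" where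
  "delta_mHoch s \<mu> R n f = (\<lambda>as. if length as \<noteq> n + 1 then 0 else
     s ((-1) ^ (n + 1)) (\<mu> (R (hd as)) (f (tl as)))
     - s ((-1) ^ (n + 1)) (R (\<mu> (hd as) (f (tl as))))
     + \<mu> (f (butlast as)) (R (last as))
     - R (\<mu> (f (butlast as)) (last as))
     + (\<Sum>i = 1..n. s ((-1) ^ (i + n + 1)) (f (contract (\<lambda>a b. \<mu> (R a) b + \<mu> a (R b)) i as))))"

text \<open>Applies \<open>R\<close> to the entries whose 0-based position is not in \<open>I\<close>.\<close>

definition R_off :: "('a \<Rightarrow> 'a) \<Rightarrow> nat set \<Rightarrow> 'a list \<Rightarrow> 'a list" where
  "R_off R I as = map (\<lambda>j. if j \<in> I then as ! j else R (as ! j)) [0..<length as]"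

definition phi ::
  "('k::field \<Rightarrow> 'a::ab_group_add \<Rightarrow> 'a) \<Rightarrow> 'k \<Rightarrow> ('a \<Rightarrow> 'a) \<Rightarrow> nat \<Rightarrow> 'a cochain \<Rightarrow> 'a cochain" where
  "phi s \<kappa> R n f = (\<lambda>as. if length as \<noteq> n then 0 else
     f (map R as)
     - (\<Sum>I | I \<subseteq> {..<n} \<and> odd (card I).
          s ((- \<kappa>) ^ ((card I - 1) div 2)) (R (f (R_off R I as))))
     + (\<Sum>I | I \<subseteq> {..<n} \<and> even (card I) \<and> card I \<ge> 2.
          s ((- \<kappa>) ^ (card I div 2)) (f (R_off R I as))))"

definition Delta :: "('a::ab_group_add \<Rightarrow> 'a) \<Rightarrow> nat \<Rightarrow> 'a cochain \<Rightarrow> 'a cochain" where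
  "Delta d n f = (\<lambda>as. if length as \<noteq> n then 0 else
     (\<Sum>i<n. f (as[i := d (as ! i)])) - d (f as))"


section \<open>The complex of a modified Rota-Baxter algebra\<close>

type_synonym 'a cochain_mRBAA = "'a cochain \<times> 'a cochain"

definition C_mRBAA ::
  "('k::field \<Rightarrow> 'a::ab_group_add \<Rightarrow> 'a) \<Rightarrow> nat \<Rightarrow> 'a cochain_mRBAA set" where
  "C_mRBAA s n = Hom_tensor s n \<times> Hom_tensor s (n - 1)"

fun d_mRBAA ::
  "('k::field \<Rightarrow> 'a::ab_group_add \<Rightarrow> 'a) \<Rightarrow> 'k \<Rightarrow> ('a \<Rightarrow> 'a \<Rightarrow> 'a) \<Rightarrow> ('a \<Rightarrow> 'a)
   \<Rightarrow> nat \<Rightarrow> 'a cochain_mRBAA \<Rightarrow> 'a cochain_mRBAA" where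
  "d_mRBAA s \<kappa> \<mu> R n (f, g) =
     (if n = 1 then (delta_Hoch s \<mu> 1 f, - phi s \<kappa> R 1 f)
      else (delta_Hoch s \<mu> n f, - delta_mHoch s \<mu> R (n - 1) g - phi s \<kappa> R n f))"

fun Delta_mRBAA ::
  "('a::ab_group_add \<Rightarrow> 'a) \<Rightarrow> nat \<Rightarrow> 'a cochain_mRBAA \<Rightarrow> 'a cochain_mRBAA" where
  "Delta_mRBAA d n (f, g) = (Delta d n f, if n = 1 then 0 else Delta d (n - 1) g)"


section \<open>The complex of a modified Rota-Baxter AssDer pair\<close>

type_synonym 'a cochain_mRBAD = "'a cochain_mRBAA \<times> 'a cochain_mRBAA"

definition C_mRBAD ::
  "('k::field \<Rightarrow> 'a::ab_group_add \<Rightarrow> 'a) \<Rightarrow> nat \<Rightarrow> 'a cochain_mRBAD set" where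
  "C_mRBAD s n = C_mRBAA s n \<times> C_mRBAA s (n - 1)"

fun D_mRBAD ::
  "('k::field \<Rightarrow> 'a::ab_group_add \<Rightarrow> 'a) \<Rightarrow> 'k \<Rightarrow> ('a \<Rightarrow> 'a \<Rightarrow> 'a) \<Rightarrow> ('a \<Rightarrow> 'a) \<Rightarrow> ('a \<Rightarrow> 'a)
   \<Rightarrow> nat \<Rightarrow> 'a cochain_mRBAD \<Rightarrow> 'a cochain_mRBAD" where
  "D_mRBAD s \<kappa> \<mu> R d n (F, G) =
     (if n = 1 then (d_mRBAA s \<kappa> \<mu> R 1 F, - Delta_mRBAA d 1 F)
      else (d_mRBAA s \<kappa> \<mu> R n F,
            d_mRBAA s \<kappa> \<mu> R (n - 1) G
            + (if even n then Delta_mRBAA d n F else - Delta_mRBAA d n F)))"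

definition cocycles ::
  "('k::field \<Rightarrow> 'a::ab_group_add \<Rightarrow> 'a) \<Rightarrow> 'k \<Rightarrow> ('a \<Rightarrow> 'a \<Rightarrow> 'a) \<Rightarrow> ('a \<Rightarrow> 'a) \<Rightarrow> ('a \<Rightarrow> 'a)
   \<Rightarrow> nat \<Rightarrow> 'a cochain_mRBAD set" where
  "cocycles s \<kappa> \<mu> R d n = {x \<in> C_mRBAD s n. D_mRBAD s \<kappa> \<mu> R d n x = 0}"

definition coboundaries ::
  "('k::field \<Rightarrow> 'a::ab_group_add \<Rightarrow> 'a) \<Rightarrow> 'k \<Rightarrow> ('a \<Rightarrow> 'a \<Rightarrow> 'a) \<Rightarrow> ('a \<Rightarrow> 'a) \<Rightarrow> ('a \<Rightarrow> 'a)
   \<Rightarrow> nat \<Rightarrow> 'a cochain_mRBAD set" where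
  "coboundaries s \<kappa> \<mu> R d n =
     (if n \<le> 1 then {0} else D_mRBAD s \<kappa> \<mu> R d (n - 1) ` C_mRBAD s (n - 1))"

definition cohomologous ::
  "('k::field \<Rightarrow> 'a::ab_group_add \<Rightarrow> 'a) \<Rightarrow> 'k \<Rightarrow> ('a \<Rightarrow> 'a \<Rightarrow> 'a) \<Rightarrow> ('a \<Rightarrow> 'a) \<Rightarrow> ('a \<Rightarrow> 'a)
   \<Rightarrow> nat \<Rightarrow> ('a cochain_mRBAD \<times> 'a cochain_mRBAD) set" where
  "cohomologous s \<kappa> \<mu> R d n =
     {(x, y). x \<in> cocycles s \<kappa> \<mu> R d n \<and> y \<in> cocycles s \<kappa> \<mu> R d n \<and>
              x - y \<in> coboundaries s \<kappa> \<mu> R d n}"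

definition cohomology ::
  "('k::field \<Rightarrow> 'a::ab_group_add \<Rightarrow> 'a) \<Rightarrow> 'k \<Rightarrow> ('a \<Rightarrow> 'a \<Rightarrow> 'a) \<Rightarrow> ('a \<Rightarrow> 'a) \<Rightarrow> ('a \<Rightarrow> 'a)
   \<Rightarrow> nat \<Rightarrow> 'a cochain_mRBAD set set" where
  "cohomology s \<kappa> \<mu> R d n = cocycles s \<kappa> \<mu> R d n // cohomologous s \<kappa> \<mu> R d n"

definition cohomology_class ::
  "('k::field \<Rightarrow> 'a::ab_group_add \<Rightarrow> 'a) \<Rightarrow> 'k \<Rightarrow> ('a \<Rightarrow> 'a \<Rightarrow> 'a) \<Rightarrow> ('a \<Rightarrow> 'a) \<Rightarrow> ('a \<Rightarrow> 'a)
   \<Rightarrow> nat \<Rightarrow> 'a cochain_mRBAD \<Rightarrow> 'a cochain_mRBAD set" where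
  "cohomology_class s \<kappa> \<mu> R d n x = cohomologous s \<kappa> \<mu> R d n `` {x}"

text \<open>The last 0 is the padding of the degree 1 cochain \<open>d\<^sub>1\<close>.\<close>

definition infinitesimal ::
  "(nat \<Rightarrow> 'a::ab_group_add \<Rightarrow> 'a \<Rightarrow> 'a) \<Rightarrow> (nat \<Rightarrow> 'a \<Rightarrow> 'a) \<Rightarrow> (nat \<Rightarrow> 'a \<Rightarrow> 'a)
   \<Rightarrow> 'a cochain_mRBAD" where
  "infinitesimal \<mu>t Rt dt =
     ((cochain2 (\<mu>t 1), cochain1 (Rt 1)), (cochain1 (dt 1), 0))"

end

theory Submission
  imports Defs
begin

text \<open>
  Every axiom of a deformation, evaluated at constant power series, is an identity between power
  series. Its coefficient of \<open>t\<^sup>1\<close> is one of the four components of the cocycle condition. In the same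
  way the coefficients of \<open>t\<^sup>1\<close> of the conditions on an equivalence \<open>\<phi>\<^sub>t\<close> say that the difference of
  the infinitesimals is the coboundary of \<open>\<phi>\<^sub>1\<close>.
\<close>

section \<open>Low-order coefficients\<close>

lemma lin_ext_nth_0: "fps_nth (lin_ext T f) 0 = T 0 (fps_nth f 0)"
  by (simp add: lin_ext_def)

text \<open>Cauchy product: in each summand exactly one factor contributes its coefficient of index
  1. The index is written \<open>Suc 0\<close> because the simplifier turns 1 into that
  form.\<close>

lemma lin_ext_nth_1:
  "fps_nth (lin_ext T f) (Suc 0) = T 0 (fps_nth f (Suc 0)) + T (Suc 0) (fps_nth f 0)"
  by (simp add: lin_ext_def)

lemma bilin_ext_nth_0: "fps_nth (bilin_ext m f g) 0 = m 0 (fps_nth f 0) (fps_nth g 0)"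
  by (simp add: bilin_ext_def)

lemma bilin_ext_nth_1:
  "fps_nth (bilin_ext m f g) (Suc 0) =
     m 0 (fps_nth f 0) (fps_nth g (Suc 0)) + m 0 (fps_nth f (Suc 0)) (fps_nth g 0)
     + m (Suc 0) (fps_nth f 0) (fps_nth g 0)"
  by (simp add: bilin_ext_def)

lemmas ext_nth = lin_ext_nth_0 lin_ext_nth_1 bilin_ext_nth_0 bilin_ext_nth_1

text \<open>The coefficients of \<open>fps_const c\<close> above index 0 vanish, so only one summand
  survives. This is needed for the weight over power series, which is
  \<open>fps_const \<kappa>\<close>.\<close>

lemma fps_scale_const_nth:
  assumes "module s"
  shows "fps_nth (fps_scale s (fps_const c) f) n = s c (fps_nth f n)"
proof -
  interpret module s by fact
  have "fps_nth (fps_scale s (fps_const c) f) n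
      = (\<Sum>i\<le>n. if i = 0 then s c (fps_nth f n) else 0)"
    unfolding fps_scale_def fps_nth_Abs_fps by (rule sum.cong) auto
  then show ?thesis by simp
qed


section \<open>Linear and bilinear maps\<close>

lemma module_hom_add: "module_hom s s f \<Longrightarrow> f (a + b) = f a + f b"
  and module_hom_diff: "module_hom s s f \<Longrightarrow> f (a - b) = f a - f b"
  and module_hom_zero: "module_hom s s f \<Longrightarrow> f 0 = 0"
  by (simp_all add: module_hom.add module_hom.diff module_hom.zero)

lemma bilinear_map_diff_left: "bilinear_map s m \<Longrightarrow> m (a - b) c = m a c - m b c"
  and bilinear_map_diff_right: "bilinear_map s m \<Longrightarrow> m a (b - c) = m a b - m a c"
  and bilinear_map_zero_left: "bilinear_map s m \<Longrightarrow> m 0 c = 0"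
  and bilinear_map_zero_right: "bilinear_map s m \<Longrightarrow> m a 0 = 0"
  using module_hom.diff[of s s "m a"] module_hom.diff[of s s "\<lambda>a. m a c"]
    module_hom.zero[of s s "m a"] module_hom.zero[of s s "\<lambda>a. m a c"]
  by (auto simp: bilinear_map_def)


section \<open>Cochains\<close>

text \<open>Degree 0 is included: it supplies the padding components of degree 1 cochains.\<close>

lemma Hom_tensor_zero: "module s \<Longrightarrow> 0 \<in> Hom_tensor s n"
  by (auto simp: Hom_tensor_def module_hom_iff module.scale_zero_right)

lemma Hom_tensor_diff:
  assumes "f \<in> Hom_tensor s n" "g \<in> Hom_tensor s n"
  shows "f - g \<in> Hom_tensor s n"
proof (cases "n = 0")
  case False
  with assms show ?thesis
    by (auto simp: Hom_tensor_def module_hom_iff module.scale_right_diff_distrib)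
qed (use assms in \<open>simp add: Hom_tensor_def\<close>)

lemma cochain1_in_Hom_tensor:
  assumes "module_hom s s f"
  shows "cochain1 f \<in> Hom_tensor s 1"
proof -
  have "module_hom s s (\<lambda>a. cochain1 f (as[i := a]))" if "length as = 1" "i < 1" for as i
    using that assms by (simp add: cochain1_def)
  then show ?thesis by (auto simp: Hom_tensor_def cochain1_def)
qed

lemma cochain2_in_Hom_tensor:
  assumes "bilinear_map s m"
  shows "cochain2 m \<in> Hom_tensor s 2"
proof -
  have "module_hom s s (\<lambda>a. cochain2 m (as[i := a]))" if "length as = 2" "i < 2" for as i
  proof -
    from \<open>i < 2\<close> consider "i = 0" | "i = 1" by linarith
    then show ?thesis
      using that assms by cases (auto simp: cochain2_def bilinear_map_def)
  qed
  then show ?thesis by (auto simp: Hom_tensor_def cochain2_def)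
qed

lemma C_mRBAD_zero: "module s \<Longrightarrow> 0 \<in> C_mRBAD s n"
  by (simp add: C_mRBAD_def C_mRBAA_def zero_prod_def Hom_tensor_zero)

lemma C_mRBAD_diff: "x \<in> C_mRBAD s n \<Longrightarrow> y \<in> C_mRBAD s n \<Longrightarrow> x - y \<in> C_mRBAD s n"
  by (auto simp: C_mRBAD_def C_mRBAA_def Hom_tensor_diff)


section \<open>Additivity of the differentials\<close>

lemma Delta_diff:
  assumes "module_hom s s d"
  shows "Delta d n (f - g) = Delta d n f - Delta d n g"
  by (rule ext) (simp add: Delta_def sum_subtractf module_hom_diff[OF assms])

lemma Delta_mRBAA_diff:
  assumes "module_hom s s d"
  shows "Delta_mRBAA d n (F - G) = Delta_mRBAA d n F - Delta_mRBAA d n G"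
  by (cases F; cases G) (simp add: Delta_diff[OF assms])

context mRB_algebra
begin

lemma R_diff: "R (a - b) = R a - R b"
  by (rule module_hom_diff[OF linear_R])

lemmas mult_diff = bilinear_map_diff_left[OF bilinear_mult] bilinear_map_diff_right[OF bilinear_mult]

end

text \<open>The locale allows any commutative ring of scalars, while the cochain operators require a
  field. Hence it is interpreted in a context whose scalars form a field.\<close>

context
  fixes s :: "'k::field \<Rightarrow> 'a::ab_group_add \<Rightarrow> 'a" and \<kappa> :: 'k and \<mu> R
  assumes mRB: "mRB_algebra s \<kappa> \<mu> R"
begin

interpretation mRB_algebra s \<kappa> \<mu> R by (rule mRB)

text \<open>Every summand evaluates the cochain at some list and then applies additive maps, so the
  identity holds for arbitrary functions on lists. The same reason works for the next two
  operators.\<close>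

lemma delta_Hoch_diff: "delta_Hoch s \<mu> n (f - g) = delta_Hoch s \<mu> n f - delta_Hoch s \<mu> n g"
  by (rule ext)
    (simp add: delta_Hoch_def mult_diff sum_subtractf sum_negf algebra_simps)

lemma delta_mHoch_diff:
  "delta_mHoch s \<mu> R n (f - g) = delta_mHoch s \<mu> R n f - delta_mHoch s \<mu> R n g"
  by (rule ext)
    (simp add: delta_mHoch_def mult_diff R_diff sum_subtractf sum_negf algebra_simps)

lemma phi_diff: "phi s \<kappa> R n (f - g) = phi s \<kappa> R n f - phi s \<kappa> R n g"
  by (rule ext)
    (simp add: phi_def R_diff sum_subtractf sum_negf algebra_simps)

lemma d_mRBAA_diff: "d_mRBAA s \<kappa> \<mu> R n (F - G) = d_mRBAA s \<kappa> \<mu> R n F - d_mRBAA s \<kappa> \<mu> R n G"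
  by (cases F; cases G) (simp add: delta_Hoch_diff delta_mHoch_diff phi_diff)

end

context
  fixes s :: "'k::field \<Rightarrow> 'a::ab_group_add \<Rightarrow> 'a" and \<kappa> :: 'k and \<mu> R d
  assumes pair: "mRB_AssDer_pair s \<kappa> \<mu> R d"
begin

interpretation mRB_AssDer_pair s \<kappa> \<mu> R d by (rule pair)

text \<open>Compatibility with differences yields both the value 0 at 0 and the closure of the image
  under subtraction, that is, the subgroup criterion.\<close>

lemma D_mRBAD_diff:
  "D_mRBAD s \<kappa> \<mu> R d n (x - y) = D_mRBAD s \<kappa> \<mu> R d n x - D_mRBAD s \<kappa> \<mu> R d n y"
proof -
  obtain F G F' G' where xy: "x = (F, G)" "y = (F', G')" by (cases x; cases y)
  show ?thesis
    unfolding xy diff_Pair D_mRBAD.simps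
      d_mRBAA_diff[OF mRB_algebra_axioms] Delta_mRBAA_diff[OF linear_d]
    by (simp del: d_mRBAA.simps Delta_mRBAA.simps)
qed

section \<open>The subgroup of coboundaries and the relation of being cohomologous\<close>

lemma coboundaries_zero: "0 \<in> coboundaries s \<kappa> \<mu> R d n"
proof (cases "n \<le> 1")
  case False
  have "D_mRBAD s \<kappa> \<mu> R d (n - 1) 0 = 0"
    \<comment> \<open>The value at 0 = 0 - 0 is the difference of that value with itself.\<close>
    using D_mRBAD_diff[of "n - 1" 0 0] by simp
  then show ?thesis
    using False C_mRBAD_zero[OF module_axioms, of "n - 1"]
    by (force simp: coboundaries_def simp del: D_mRBAD.simps)
qed (simp add: coboundaries_def)

lemma coboundaries_diff:
  assumes "x \<in> coboundaries s \<kappa> \<mu> R d n" "y \<in> coboundaries s \<kappa> \<mu> R d n"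
  shows "x - y \<in> coboundaries s \<kappa> \<mu> R d n"
proof (cases "n \<le> 1")
  case False
  then obtain x' y' where C: "x' \<in> C_mRBAD s (n - 1)" "x = D_mRBAD s \<kappa> \<mu> R d (n - 1) x'"
      "y' \<in> C_mRBAD s (n - 1)" "y = D_mRBAD s \<kappa> \<mu> R d (n - 1) y'"
    using assms unfolding coboundaries_def by auto
  then have "x - y = D_mRBAD s \<kappa> \<mu> R d (n - 1) (x' - y')"
    by (simp only: D_mRBAD_diff)
  then show ?thesis
    using False C_mRBAD_diff[OF C(1,3)] by (simp add: coboundaries_def del: D_mRBAD.simps)
qed (use assms in \<open>simp add: coboundaries_def\<close>)

text \<open>Congruence modulo a subgroup, restricted to cocycles, is an equivalence
  relation.\<close>

lemma equiv_cohomologous: "equiv (cocycles s \<kappa> \<mu> R d n) (cohomologous s \<kappa> \<mu> R d n)"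
proof (rule equivI)
  show "cohomologous s \<kappa> \<mu> R d n \<subseteq> cocycles s \<kappa> \<mu> R d n \<times> cocycles s \<kappa> \<mu> R d n"
    by (auto simp: cohomologous_def)
  show "refl_on (cocycles s \<kappa> \<mu> R d n) (cohomologous s \<kappa> \<mu> R d n)"
    by (auto simp: refl_on_def cohomologous_def coboundaries_zero)
  show "sym (cohomologous s \<kappa> \<mu> R d n)"
  proof (rule symI)
    fix x y assume "(x, y) \<in> cohomologous s \<kappa> \<mu> R d n"
    then show "(y, x) \<in> cohomologous s \<kappa> \<mu> R d n"
      using coboundaries_diff[OF coboundaries_zero, of "x - y" n]
      unfolding cohomologous_def by simp
  qed
  show "trans (cohomologous s \<kappa> \<mu> R d n)"
  proof (rule transI)
    fix x y z
    assume xy: "(x, y) \<in> cohomologous s \<kappa> \<mu> R d n" and yz: "(y, z) \<in> cohomologous s \<kappa> \<mu> R d n"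
    \<comment> \<open>Closure is available for subtraction only, so x - z is written as (x - y) - (z
      - y), and z - y as 0 - (y - z).\<close>
    have "z - y \<in> coboundaries s \<kappa> \<mu> R d n"
      using coboundaries_diff[OF coboundaries_zero, of "y - z" n] yz
      unfolding cohomologous_def by simp
    then show "(x, z) \<in> cohomologous s \<kappa> \<mu> R d n"
      using coboundaries_diff[of "x - y" n "z - y"] xy yz
      unfolding cohomologous_def by simp
  qed
qed


section \<open>The operators in low degrees\<close>

lemma delta_Hoch_1:
  "delta_Hoch s \<mu> 1 (cochain1 f) = cochain2 (\<lambda>a b. \<mu> a (f b) + \<mu> (f a) b - f (\<mu> a b))"
proof
  fix as show "delta_Hoch s \<mu> 1 (cochain1 f) as
      = cochain2 (\<lambda>a b. \<mu> a (f b) + \<mu> (f a) b - f (\<mu> a b)) as"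
  proof (cases "length as = 2")
    case True
    then obtain a b where "as = [a, b]"
      by (auto simp: numeral_2_eq_2 length_Suc_conv)
    then show ?thesis
      by (simp add: delta_Hoch_def cochain1_def cochain2_def contract_def)
  qed (simp add: delta_Hoch_def cochain2_def)
qed

text \<open>This is the coefficient of t in the associator of \<open>\<mu> + t m\<close>.\<close>

lemma delta_Hoch_2:
  "delta_Hoch s \<mu> 2 (cochain2 m) [a, b, c] =
     \<mu> (m a b) c + m (\<mu> a b) c - \<mu> a (m b c) - m a (\<mu> b c)"
  by (simp add: delta_Hoch_def cochain2_def contract_def numeral_2_eq_2)

lemma delta_mHoch_1:
  "delta_mHoch s \<mu> R 1 (cochain1 f) [a, b] =
     \<mu> (R a) (f b) - R (\<mu> a (f b)) + \<mu> (f a) (R b) - R (\<mu> (f a) b)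
     - f (\<mu> (R a) b + \<mu> a (R b))"
  by (simp add: delta_mHoch_def cochain1_def contract_def)

text \<open>The only index set that contributes is {0}, with coefficient 1; the even sum is empty.
  The result is the commutator of f and R.\<close>

lemma phi_1: "phi s \<kappa> R 1 (cochain1 f) = cochain1 (\<lambda>a. f (R a) - R (f a))"
proof -
  have Pow: "I \<subseteq> {..<Suc 0} \<longleftrightarrow> I = {} \<or> I = {0}" for I :: "nat set"
    by (simp add: lessThan_Suc subset_singleton_iff)
  have odd: "{I. I \<subseteq> {..<Suc 0} \<and> odd (card I)} = {{0}}"
    unfolding Pow by auto
  have even: "{I. I \<subseteq> {..<Suc 0} \<and> even (card I) \<and> 2 \<le> card I} = {}"
    unfolding Pow by auto
  show ?thesis
  proof
    fix as show "phi s \<kappa> R 1 (cochain1 f) as = cochain1 (\<lambda>a. f (R a) - R (f a)) as"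
    proof (cases "length as = 1")
      case True
      then obtain a where "as = [a]" by (auto simp: length_Suc_conv)
      then show ?thesis by (simp add: phi_def odd even cochain1_def R_off_def)
    qed (simp add: phi_def cochain1_def)
  qed
qed

text \<open>The two singletons have coefficient \<open>(- \<kappa>) ^ 0\<close>, and {0, 1} has
  coefficient \<open>- \<kappa>\<close>.\<close>

lemma phi_2:
  "phi s \<kappa> R 2 (cochain2 m) [a, b] =
     m (R a) (R b) - R (m a (R b)) - R (m (R a) b) - s \<kappa> (m a b)"
proof -
  have Pow: "I \<subseteq> {..<2} \<longleftrightarrow> I = {} \<or> I = {0} \<or> I = {1} \<or> I = {0, 1}" for I :: "nat set"
    by (simp add: lessThan_Suc numeral_2_eq_2) blast
  have odd: "{I. I \<subseteq> {..<2} \<and> odd (card I)} = {{0}, {1 :: nat}}"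
    unfolding Pow by auto
  have even: "{I. I \<subseteq> {..<2} \<and> even (card I) \<and> 2 \<le> card I} = {{0, 1 :: nat}}"
    unfolding Pow by auto
  \<comment> \<open>The sum over the two singletons splits only once they are known to be
    distinct.\<close>
  have ne: "{0} \<noteq> {1 :: nat}" by simp
  show ?thesis
    unfolding phi_def odd even using ne by (simp add: cochain2_def R_off_def)
qed

lemma Delta_1: "Delta d 1 (cochain1 f) = cochain1 (\<lambda>a. f (d a) - d (f a))"
  by (rule ext) (simp add: Delta_def cochain1_def)

lemma Delta_2: "Delta d 2 (cochain2 m) = cochain2 (\<lambda>a b. m (d a) b + m a (d b) - d (m a b))"
  by (rule ext) (simp add: Delta_def cochain2_def numeral_2_eq_2)

end


section \<open>Infinitesimals\<close>

lemma infinitesimal_in_cochains: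
  assumes "formal_deformation s \<kappa> \<mu> R d \<mu>t Rt dt"
  shows "infinitesimal \<mu>t Rt dt \<in> C_mRBAD s 2"
proof -
  have "module_hom s s (Rt 1)" "module_hom s s (dt 1)" "bilinear_map s (\<mu>t 1)"
    using assms by (auto simp: formal_deformation_def)
  moreover have "module s"
    using \<open>module_hom s s (Rt 1)\<close> by (simp add: module_hom_iff)
  ultimately show ?thesis
    \<comment> \<open>\<open>[simplified]\<close> restates degree 1 as \<open>Suc 0\<close>, the
      form in which the goal presents it.\<close>
    by (simp add: infinitesimal_def C_mRBAD_def C_mRBAA_def cochain2_in_Hom_tensor
        cochain1_in_Hom_tensor[simplified] Hom_tensor_zero)
qed

text \<open>Associativity and the Rota-Baxter identity give the two components of the first pair;
  the derivation rule and commutation of R with d give those of the second.\<close>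

lemma D_infinitesimal:
  assumes pair: "mRB_AssDer_pair s \<kappa> \<mu> R d"
    and deform: "formal_deformation s \<kappa> \<mu> R d \<mu>t Rt dt"
  shows "D_mRBAD s \<kappa> \<mu> R d 2 (infinitesimal \<mu>t Rt dt) = 0"
proof -
  interpret mRB_AssDer_pair s \<kappa> \<mu> R d by (rule pair)
  interpret t: mRB_AssDer_pair "fps_scale s" "fps_const \<kappa>" "bilin_ext \<mu>t" "lin_ext Rt" "lin_ext dt"
    using deform by (simp add: formal_deformation_def)
  have at_0: "\<mu>t 0 = \<mu>" "Rt 0 = R" "dt 0 = d"
    using deform by (auto simp: formal_deformation_def)
  have lin: "module_hom s s (Rt i)" "module_hom s s (dt i)" for i
    using deform by (auto simp: formal_deformation_def)
  have bilin: "bilinear_map s (\<mu>t i)" for i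
    using deform by (auto simp: formal_deformation_def)
  \<comment> \<open>Constant series have no coefficient of t, so every term containing that
    coefficient of an argument has a zero argument and drops out.\<close>
  note zero = bilinear_map_zero_left[OF bilinear_mult] bilinear_map_zero_right[OF bilinear_mult]
    bilinear_map_zero_left[OF bilin] bilinear_map_zero_right[OF bilin]
    module_hom_zero[OF linear_R] module_hom_zero[OF linear_d]
    module_hom_zero[OF lin(1)] module_hom_zero[OF lin(2)]
  note add = module_hom_add[OF linear_R] module_hom_add[OF linear_d]
    module_hom_add[OF lin(1)] module_hom_add[OF lin(2)]
  note coeff = ext_nth at_0 zero add fps_scale_const_nth[OF module_axioms]
  have assoc: "\<mu> (\<mu>t 1 a b) c + \<mu>t 1 (\<mu> a b) c = \<mu> a (\<mu>t 1 b c) + \<mu>t 1 a (\<mu> b c)" for a b c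
    using arg_cong[OF t.assoc_mult[of "fps_const a" "fps_const b" "fps_const c"],
        of "\<lambda>f. fps_nth f 1"]
    by (simp add: coeff)
  have RB: "\<mu> (R a) (Rt 1 b) + \<mu> (Rt 1 a) (R b) + \<mu>t 1 (R a) (R b) =
      R (\<mu> (Rt 1 a) b + \<mu>t 1 (R a) b + \<mu> a (Rt 1 b) + \<mu>t 1 a (R b))
      + Rt 1 (\<mu> (R a) b + \<mu> a (R b)) + s \<kappa> (\<mu>t 1 a b)" for a b
    using arg_cong[OF t.modified_Rota_Baxter[of "fps_const a" "fps_const b"],
        of "\<lambda>f. fps_nth f 1"]
    by (simp add: coeff algebra_simps)
  have der: "d (\<mu>t 1 a b) + dt 1 (\<mu> a b) =
      \<mu> (dt 1 a) b + \<mu>t 1 (d a) b + \<mu> a (dt 1 b) + \<mu>t 1 a (d b)" for a b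
    using arg_cong[OF t.derivation[of "fps_const a" "fps_const b"], of "\<lambda>f. fps_nth f 1"]
    by (simp add: coeff algebra_simps)
  have comm: "R (dt 1 a) + Rt 1 (d a) = d (Rt 1 a) + dt 1 (R a)" for a
    using arg_cong[OF fun_cong[OF t.commute, of "fps_const a"], of "\<lambda>f. fps_nth f 1"]
    by (simp add: coeff)
  have "delta_Hoch s \<mu> 2 (cochain2 (\<mu>t 1)) = 0"
  proof
    fix as show "delta_Hoch s \<mu> 2 (cochain2 (\<mu>t 1)) as = 0 as"
    \<comment> \<open>On lists of any other length the operator is 0 by its padding
      convention.\<close>
    proof (cases "length as = 3")
      case True
      then obtain a b c where "as = [a, b, c]"
        by (auto simp: numeral_3_eq_3 length_Suc_conv)
      then show ?thesis
        using assoc[of a b c] by (simp add: delta_Hoch_2[OF pair])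
    qed (simp add: delta_Hoch_def)
  qed
  moreover have "- delta_mHoch s \<mu> R 1 (cochain1 (Rt 1)) - phi s \<kappa> R 2 (cochain2 (\<mu>t 1)) = 0"
  proof
    fix as
    show "(- delta_mHoch s \<mu> R 1 (cochain1 (Rt 1)) - phi s \<kappa> R 2 (cochain2 (\<mu>t 1))) as = 0 as"
    proof (cases "length as = 2")
      case True
      then obtain a b where "as = [a, b]"
        by (auto simp: numeral_2_eq_2 length_Suc_conv)
      then show ?thesis
        \<comment> \<open>The component is the right side of \<open>RB\<close> minus its left
          side.\<close>
        using RB[of a b]
        by (simp add: delta_mHoch_1[OF pair, simplified] phi_2[OF pair] add algebra_simps)
    qed (simp add: delta_mHoch_def phi_def)
  qed
  \<comment> \<open>\<open>Delta_mRBAA\<close> enters with a plus sign since the degree 2 is even.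
    The sum is the right side of \<open>der\<close> minus its left side.\<close>
  moreover have "delta_Hoch s \<mu> 1 (cochain1 (dt 1)) + Delta d 2 (cochain2 (\<mu>t 1)) = 0"
    unfolding delta_Hoch_1[OF pair] Delta_2[OF pair]
    using der by (auto simp: fun_eq_iff cochain2_def algebra_simps)
  \<comment> \<open>Both terms are commutators, and their combination is the left side of
    \<open>comm\<close> minus its right side.\<close>
  moreover have "- phi s \<kappa> R 1 (cochain1 (dt 1)) + Delta d 1 (cochain1 (Rt 1)) = 0"
    unfolding phi_1[OF pair] Delta_1[OF pair]
    using comm by (auto simp: fun_eq_iff cochain1_def algebra_simps)
  ultimately show ?thesis
    by (simp add: infinitesimal_def zero_prod_def)
qed

lemma infinitesimal_in_cocycles:
  assumes "mRB_AssDer_pair s \<kappa> \<mu> R d" and "formal_deformation s \<kappa> \<mu> R d \<mu>t Rt dt"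
  shows "infinitesimal \<mu>t Rt dt \<in> cocycles s \<kappa> \<mu> R d 2"
  using infinitesimal_in_cochains[OF assms(2)] D_infinitesimal[OF assms]
  by (simp add: cocycles_def)

text \<open>Since \<open>\<phi> 0 = id\<close>, comparing coefficients of t leaves
  \<open>\<phi> 1\<close> as the only unknown map. As \<open>\<phi>\<close> carries the first
  deformation to the second, first minus second is the coboundary of \<open>\<phi> 1\<close> with no
  extra sign.\<close>

lemma infinitesimal_diff_in_coboundaries:
  assumes pair: "mRB_AssDer_pair s \<kappa> \<mu> R d"
    and deform: "formal_deformation s \<kappa> \<mu> R d \<mu>t Rt dt"
    and deform': "formal_deformation s \<kappa> \<mu> R d \<mu>t' Rt' dt'"
    and equivalent: "equivalent_deformations s \<mu>t Rt dt \<mu>t' Rt' dt'"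
  shows "infinitesimal \<mu>t Rt dt - infinitesimal \<mu>t' Rt' dt' \<in> coboundaries s \<kappa> \<mu> R d 2"
proof -
  interpret mRB_AssDer_pair s \<kappa> \<mu> R d by (rule pair)
  obtain \<phi> where lin: "\<And>i. module_hom s s (\<phi> i)" and \<phi>_0: "\<phi> 0 = id"
    and mult: "\<And>a b. lin_ext \<phi> (bilin_ext \<mu>t a b) = bilin_ext \<mu>t' (lin_ext \<phi> a) (lin_ext \<phi> b)"
    and R: "lin_ext \<phi> \<circ> lin_ext Rt = lin_ext Rt' \<circ> lin_ext \<phi>"
    and d: "lin_ext \<phi> \<circ> lin_ext dt = lin_ext dt' \<circ> lin_ext \<phi>"
    using equivalent unfolding equivalent_deformations_def by blast
  have at_0: "\<mu>t 0 = \<mu>" "Rt 0 = R" "dt 0 = d" "\<mu>t' 0 = \<mu>" "Rt' 0 = R" "dt' 0 = d"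
    using deform deform' by (auto simp: formal_deformation_def)
  note coeff = ext_nth at_0 \<phi>_0 module_hom_zero[OF lin]
    bilinear_map_zero_left[OF bilinear_mult] bilinear_map_zero_right[OF bilinear_mult]
    module_hom_zero[OF linear_R] module_hom_zero[OF linear_d]
  have "\<mu>t 1 a b - \<mu>t' 1 a b = \<mu> a (\<phi> 1 b) + \<mu> (\<phi> 1 a) b - \<phi> 1 (\<mu> a b)" for a b
    using arg_cong[OF mult[of "fps_const a" "fps_const b"], of "\<lambda>f. fps_nth f 1"]
    by (simp add: coeff algebra_simps)
  then have "cochain2 (\<mu>t 1) - cochain2 (\<mu>t' 1) = delta_Hoch s \<mu> 1 (cochain1 (\<phi> 1))"
    unfolding delta_Hoch_1[OF pair] by (auto simp: fun_eq_iff cochain2_def)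
  moreover have "Rt 1 a - Rt' 1 a = - (\<phi> 1 (R a) - R (\<phi> 1 a))" for a
    using arg_cong[OF fun_cong[OF R, of "fps_const a"], of "\<lambda>f. fps_nth f 1"]
    by (simp add: coeff algebra_simps)
  then have "cochain1 (Rt 1) - cochain1 (Rt' 1) = - phi s \<kappa> R 1 (cochain1 (\<phi> 1))"
    unfolding phi_1[OF pair] by (auto simp: fun_eq_iff cochain1_def)
  moreover have "dt 1 a - dt' 1 a = - (\<phi> 1 (d a) - d (\<phi> 1 a))" for a
    using arg_cong[OF fun_cong[OF d, of "fps_const a"], of "\<lambda>f. fps_nth f 1"]
    by (simp add: coeff algebra_simps)
  then have "cochain1 (dt 1) - cochain1 (dt' 1) = - Delta d 1 (cochain1 (\<phi> 1))"
    unfolding Delta_1[OF pair] by (auto simp: fun_eq_iff cochain1_def)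
  ultimately have "infinitesimal \<mu>t Rt dt - infinitesimal \<mu>t' Rt' dt'
      = D_mRBAD s \<kappa> \<mu> R d 1 ((cochain1 (\<phi> 1), 0), 0)"
    by (simp add: infinitesimal_def)
  \<comment> \<open>The outer 0 is a pair of degree 0 cochains, because \<open>0 - 1 = 0\<close> on
    natural numbers.\<close>
  moreover have "((cochain1 (\<phi> 1), 0), 0) \<in> C_mRBAD s 1"
    using cochain1_in_Hom_tensor[OF lin, of 1] Hom_tensor_zero[OF module_axioms]
    by (simp add: C_mRBAD_def C_mRBAA_def zero_prod_def)
  ultimately have "infinitesimal \<mu>t Rt dt - infinitesimal \<mu>t' Rt' dt'
      \<in> D_mRBAD s \<kappa> \<mu> R d 1 ` C_mRBAD s 1"
    by (rule image_eqI)
  then show ?thesis by (simp add: coboundaries_def del: D_mRBAD.simps)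
qed

theorem theorem4p5:
  fixes s :: "'k::field \<Rightarrow> 'a::ab_group_add \<Rightarrow> 'a"
    and \<kappa> :: 'k and \<mu> :: "'a \<Rightarrow> 'a \<Rightarrow> 'a" and R d :: "'a \<Rightarrow> 'a"
  assumes "vector_space s"
    and "mRB_AssDer_pair s \<kappa> \<mu> R d"
  shows "(\<forall>\<mu>t Rt dt. formal_deformation s \<kappa> \<mu> R d \<mu>t Rt dt \<longrightarrow>
           infinitesimal \<mu>t Rt dt \<in> C_mRBAD s 2 \<and>
           D_mRBAD s \<kappa> \<mu> R d 2 (infinitesimal \<mu>t Rt dt) = 0 \<and>
           cohomology_class s \<kappa> \<mu> R d 2 (infinitesimal \<mu>t Rt dt) \<in> cohomology s \<kappa> \<mu> R d 2) \<and>
         (\<forall>\<mu>t Rt dt \<mu>t' Rt' dt'.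
           formal_deformation s \<kappa> \<mu> R d \<mu>t Rt dt \<longrightarrow>
           formal_deformation s \<kappa> \<mu> R d \<mu>t' Rt' dt' \<longrightarrow>
           equivalent_deformations s \<mu>t Rt dt \<mu>t' Rt' dt' \<longrightarrow>
           cohomology_class s \<kappa> \<mu> R d 2 (infinitesimal \<mu>t Rt dt) =
           cohomology_class s \<kappa> \<mu> R d 2 (infinitesimal \<mu>t' Rt' dt'))"
proof (intro conjI allI impI)
  fix \<mu>t Rt dt
  assume deform: "formal_deformation s \<kappa> \<mu> R d \<mu>t Rt dt"
  show "infinitesimal \<mu>t Rt dt \<in> C_mRBAD s 2"
    by (rule infinitesimal_in_cochains[OF deform])
  show "D_mRBAD s \<kappa> \<mu> R d 2 (infinitesimal \<mu>t Rt dt) = 0"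
    by (rule D_infinitesimal[OF assms(2) deform])
  show "cohomology_class s \<kappa> \<mu> R d 2 (infinitesimal \<mu>t Rt dt) \<in> cohomology s \<kappa> \<mu> R d 2"
    unfolding cohomology_class_def cohomology_def
    by (rule quotientI[OF infinitesimal_in_cocycles[OF assms(2) deform]])
next
  fix \<mu>t Rt dt \<mu>t' Rt' dt'
  assume deform: "formal_deformation s \<kappa> \<mu> R d \<mu>t Rt dt"
    and deform': "formal_deformation s \<kappa> \<mu> R d \<mu>t' Rt' dt'"
    and equivalent: "equivalent_deformations s \<mu>t Rt dt \<mu>t' Rt' dt'"
  \<comment> \<open>Related elements of an equivalence relation have the same class, so it suffices
    that both are cocycles differing by a coboundary.\<close>
  have "(infinitesimal \<mu>t Rt dt, infinitesimal \<mu>t' Rt' dt') \<in> cohomologous s \<kappa> \<mu> R d 2"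
    using infinitesimal_in_cocycles[OF assms(2) deform]
      infinitesimal_in_cocycles[OF assms(2) deform']
      infinitesimal_diff_in_coboundaries[OF assms(2) deform deform' equivalent]
    by (simp add: cohomologous_def)
  then show "cohomology_class s \<kappa> \<mu> R d 2 (infinitesimal \<mu>t Rt dt) =
      cohomology_class s \<kappa> \<mu> R d 2 (infinitesimal \<mu>t' Rt' dt')"
    unfolding cohomology_class_def by (rule equiv_class_eq[OF equiv_cohomologous[OF assms(2)]])
qed

end
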